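(* Suppose that the neighbor graph $\mathbb{G}$ is a connected two-island network, with islands $\mathcal{V}_1=\{1,\dots,n_1\}$ and $\mathcal{V}_2=\{n_1+1,\dots,N\}$, $|\mathcal{V}_2|=n_2$, and that $w_{ij}=1$ for $i\neq j$, $i,j\in\mathcal{V}$. Then $x_e^\ast=[\mathbf{0}_{n_1}^\top,\mathbf{1}_{n_2}^\top]^\top$ is a locally exponentially stable equilibrium of the system $x(k+1)=F(x(k))$ when $b_i\ge 1$ for all $i\in\mathcal{V}$.
   Context: There are $N$ agents, $\mathcal{V}=\{1,\dots,N\}$. $\mathbb{G}=(\mathcal{V},\mathcal{E})$ is a graph without self-loops, and $\mathcal{N}_i=\{j\in\mathcal{V}:(j,i)\in\mathcal{E}\}$ is the set of neighbors of agent $i$ (so $i\notin\mathcal{N}_i$). The weight matrix $W=(w_{ij})_{N\times N}$ has self-weights $w_{ii}\ge 0$; only the weights $w_{ij}$ with $j\in\mathcal{N}_i$ or $j=i$ enter the dynamics. Two-island network (used to model a homophilous network): an undirected network whose nodes are partitioned into two types, with $\mathcal{V}_i$ the set of nodes of type $i$ and $|\mathcal{V}_i|=n_i$, $i=1,2$; without loss of generality $\mathcal{V}_1=\{1,\dots,n_1\}$ and $\mathcal{V}_2=\{n_1+1,\dots,N\}$. Each node in $\mathcal{V}_1$ has $n_1p_s$ neighbors in $\mathcal{V}_1$ and $n_1p_d$ neighbors in $\mathcal{V}_2$, and each node in $\mathcal{V}_2$ has $n_2p_s$ neighbors in $\mathcal{V}_2$ and $n_2p_d$ neighbors in $\mathcal{V}_1$,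 where $p_s,p_d\in(0,1)$ and $n_1p_s,n_1p_d,n_2p_s,n_2p_d$ are all integers. Each agent $i$ has a real bias parameter $b_i$. Put $d_i=\sum_{j\in\mathcal{N}_i}w_{ij}$ and, for $x=(x_1,\dots,x_N)^\top$, $s_i=\sum_{j\in\mathcal{N}_i}w_{ij}x_j$ and $$f_i(x)=\frac{w_{ii}x_i+x_i^{b_i}s_i}{w_{ii}+x_i^{b_i}s_i+(1-x_i)^{b_i}(d_i-s_i)},\qquad F(x)=[f_1(x),\dots,f_N(x)]^\top.$$ The opinion dynamics is $x(k+1)=F(x(k))$, $k=0,1,2,\dots$, with $x_i(0)\in[0,1]$ for all $i$. $\mathbf{0}_n$ and $\mathbf{1}_n$ are the $n$-dimensional all-zero and all-one vectors, so $x_e^\ast$ has entries $0$ on $\mathcal{V}_1$ and $1$ on $\mathcal{V}_2$. Local exponential stability is in the usual sense for equilibria of discrete-time systems.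
   Formalization: The added assumption is that p_s > p_d or b_i > 1 for all i; without it the claim fails, e.g. on the 4-cycle with n_1 = n_2 = 2, p_s = p_d = 1/2 and all w_ii = b_i = 1, where a perturbation of one coordinate of x_e* never decays. *)

theory Defs
  imports "HOL-Analysis.Analysis"
begin

text \<open>The agents are the elements of a finite type, and a pair \<open>(j, i)\<close> in the edge
  relation means that \<open>j\<close> is a neighbor of \<open>i\<close>.\<close>

definition neighbors :: "('n \<times> 'n) set \<Rightarrow> 'n \<Rightarrow> 'n set" where
  "neighbors E i = {j. (j, i) \<in> E}"

definition connected_graph :: "('n \<times> 'n) set \<Rightarrow> bool" where
  "connected_graph E \<longleftrightarrow> (\<forall>i j. (i, j) \<in> E\<^sup>*)"

text \<open>The islands are arbitrary complementary sets of agents, rather than initial and final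
  segments of a numbering.\<close>

definition two_island_network ::
    "('n::finite \<times> 'n) set \<Rightarrow> 'n set \<Rightarrow> 'n set \<Rightarrow> real \<Rightarrow> real \<Rightarrow> bool" where
  "two_island_network E V1 V2 ps pd \<longleftrightarrow>
     sym E \<and> irrefl E \<and>
     V1 \<union> V2 = UNIV \<and> V1 \<inter> V2 = {} \<and>
     0 < ps \<and> ps < 1 \<and> 0 < pd \<and> pd < 1 \<and>
     real (card V1) * ps \<in> \<int> \<and> real (card V1) * pd \<in> \<int> \<and>
     real (card V2) * ps \<in> \<int> \<and> real (card V2) * pd \<in> \<int> \<and>
     (\<forall>i\<in>V1. real (card (neighbors E i \<inter> V1)) = real (card V1) * ps \<and>
             real (card (neighbors E i \<inter> V2)) = real (card V1) * pd) \<and>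
     (\<forall>i\<in>V2. real (card (neighbors E i \<inter> V2)) = real (card V2) * ps \<and>
             real (card (neighbors E i \<inter> V1)) = real (card V2) * pd)"

definition neighbor_weight :: "('n \<times> 'n) set \<Rightarrow> real^'n^'n \<Rightarrow> 'n::finite \<Rightarrow> real" where
  "neighbor_weight E W i = (\<Sum>j\<in>neighbors E i. W $ i $ j)"

definition neighbor_opinion ::
    "('n \<times> 'n) set \<Rightarrow> real^'n^'n \<Rightarrow> real^'n \<Rightarrow> 'n::finite \<Rightarrow> real" where
  "neighbor_opinion E W x i = (\<Sum>j\<in>neighbors E i. W $ i $ j * x $ j)"

text \<open>For opinions in the unit interval and positive exponents, \<open>powr\<close> is the real power,
  with \<open>0 powr a = 0\<close>. A quotient \<open>0 / 0\<close> has the value \<open>0\<close>; in a network with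
  positive neighbor weights it arises only for an agent without self-weight whose opinion
  is 0 (or 1) while all its neighbors have the opposite opinion 1 (or 0), or for an isolated
  agent without self-weight.\<close>

definition opinion_map ::
    "('n::finite \<times> 'n) set \<Rightarrow> real^'n^'n \<Rightarrow> real^'n \<Rightarrow> real^'n \<Rightarrow> real^'n" where
  "opinion_map E W b x = (\<chi> i.
     let d = neighbor_weight E W i; s = neighbor_opinion E W x i in
       (W $ i $ i * x $ i + x $ i powr b $ i * s) /
       (W $ i $ i + x $ i powr b $ i * s + (1 - x $ i) powr b $ i * (d - s)))"

text \<open>Equilibria and local exponential stability of the discrete-time system
  \<open>x(k + 1) = F (x(k))\<close> with initial states in \<open>D\<close>; the state at time \<open>k\<close> is
  \<open>(F ^^ k) x0\<close>.\<close>

definition equilibrium_on :: "'a set \<Rightarrow> ('a \<Rightarrow> 'a) \<Rightarrow> 'a \<Rightarrow> bool" where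
  "equilibrium_on D F xe \<longleftrightarrow> xe \<in> D \<and> F xe = xe"

definition locally_exponentially_stable_on ::
    "'a::metric_space set \<Rightarrow> ('a \<Rightarrow> 'a) \<Rightarrow> 'a \<Rightarrow> bool" where
  "locally_exponentially_stable_on D F xe \<longleftrightarrow>
     (\<exists>\<delta>>0. \<exists>C>0. \<exists>\<rho>. 0 < \<rho> \<and> \<rho> < 1 \<and>
        (\<forall>x0\<in>D. dist x0 xe < \<delta> \<longrightarrow>
           (\<forall>k. dist ((F ^^ k) x0) xe \<le> C * \<rho> ^ k * dist x0 xe)))"

end

theory Submission
  imports Defs
begin

text \<open>Near a state in which one camp of agents holds opinion 0 and the other opinion 1, the
  dynamics contract every coordinate separately. Let \<open>u\<close> be the distance of an agent from
  the opinion of its camp, \<open>a\<close> the weighted pull of its neighbors away from that opinion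
  and \<open>c\<close> their pull towards it. After one step, the distance is
  \<open>(w u + u\<^sup>b a) / (w + u\<^sup>b a + (1 - u)\<^sup>b c)\<close>, whichever camp the agent belongs to, because
  the update rule is symmetric under exchanging the opinions 0 and 1. This is at most \<open>u\<close>
  times a factor that tends, as the state approaches the polarized one, to
  \<open>w / (w + c)\<close> if \<open>b > 1\<close> and to \<open>(w + a) / (w + c)\<close> if \<open>b = 1\<close>, with \<open>a\<close> and \<open>c\<close>
  evaluated at the polarized state. The first limit is below 1 as soon as the agent's own camp
  exerts some pull; the second one is below 1 only if the own camp outweighs the other one.
  For an agent on an island of \<open>n\<close> nodes in a two-island network, \<open>a\<close> and \<open>c\<close> are \<open>n p\<^sub>d\<close> and
  \<open>n p\<^sub>s\<close>. So \<open>c\<close> is always positive, and agents with \<open>b = 1\<close> need \<open>p\<^sub>s > p\<^sub>d\<close>.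

  There are finitely many agents, so one factor \<open>\<rho> < 1\<close> serves all coordinates near the
  polarized state (\<open>polarized_state_contraction\<close>). A map that contracts distances to a
  point in this way fixes the point and is exponentially stable there
  (\<open>local_contraction_imp_stable\<close>). Working with such a bound instead of a Jacobian avoids
  any differentiability question at the boundary of the unit cube.\<close>

section \<open>Contractions towards a point\<close>

text \<open>The filter below lives on the neighborhoods of \<open>xe\<close> in \<open>D\<close> with \<open>xe\<close> included, so the
  bound also holds at \<open>xe\<close>, where it says that \<open>xe\<close> is fixed.\<close>

lemma local_contraction_imp_stable:
  fixes F :: "'a::metric_space \<Rightarrow> 'a"
  assumes inv: "\<And>x. x \<in> D \<Longrightarrow> F x \<in> D"
    and xe: "xe \<in> D"
    and rho: "0 < \<rho>" "\<rho> < 1"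
    and contr: "eventually (\<lambda>x. dist (F x) xe \<le> \<rho> * dist x xe) (inf (nhds xe) (principal D))"
  shows "equilibrium_on D F xe \<and> locally_exponentially_stable_on D F xe"
proof -
  obtain \<delta> where \<delta>: "\<delta> > 0"
    and step: "\<And>x. x \<in> D \<Longrightarrow> dist x xe < \<delta> \<Longrightarrow> dist (F x) xe \<le> \<rho> * dist x xe"
    using contr by (auto simp: eventually_inf_principal eventually_nhds_metric)
  have "F xe = xe"
    using step[OF xe] \<delta> by simp
  moreover have "(F ^^ k) x \<in> D \<and> dist ((F ^^ k) x) xe \<le> \<rho> ^ k * dist x xe"
    if x: "x \<in> D" "dist x xe < \<delta>" for x k
  proof (induction k)
    case 0
    then show ?case using x by simp
  next
    case (Suc k)
    have "\<rho> ^ k * dist x xe \<le> 1 * dist x xe"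
      using rho by (intro mult_right_mono power_le_one) auto
    then have "dist ((F ^^ k) x) xe < \<delta>"
      using Suc x by linarith
    then have "dist (F ((F ^^ k) x)) xe \<le> \<rho> * dist ((F ^^ k) x) xe"
      using Suc step by blast
    also have "\<dots> \<le> \<rho> * (\<rho> ^ k * dist x xe)"
      using Suc rho by (intro mult_left_mono) auto
    finally show ?case
      using Suc inv by (simp add: mult.assoc)
  qed
  ultimately show ?thesis
    unfolding equilibrium_on_def locally_exponentially_stable_on_def
    using xe \<delta> rho
    by (intro conjI exI[of _ \<delta>] exI[of _ "1::real"] exI[of _ \<rho>]) auto
qed

section \<open>The update rule of a single agent\<close>

text \<open>Here \<open>w\<close> is the self-weight and \<open>u\<close> the opinion of an agent; \<open>a\<close> is the total weight
  that its neighbors put on opinion 1, and \<open>c\<close> the weight they put on opinion 0.\<close>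

definition biased_update :: "real \<Rightarrow> real \<Rightarrow> real \<Rightarrow> real \<Rightarrow> real \<Rightarrow> real" where
  "biased_update w b u a c =
     (w * u + u powr b * a) / (w + u powr b * a + (1 - u) powr b * c)"

text \<open>Exchanging the opinions 0 and 1 turns \<open>u\<close> into \<open>1 - u\<close> and swaps the two pulls. The
  denominator is invariant. If it vanished, both quotients would be 0 and the symmetry would
  fail.\<close>

lemma biased_update_complement:
  assumes "w + u powr b * a + (1 - u) powr b * c \<noteq> 0"
  shows "1 - biased_update w b u a c = biased_update w b (1 - u) c a"
proof -
  have "w + (1 - u) powr b * c + u powr b * a = w + u powr b * a + (1 - u) powr b * c"
    by simp
  then show ?thesis
    using assms unfolding biased_update_def by (simp add: field_simps)
qed

lemma biased_update_bounds:
  assumes "w \<ge> 0" "0 \<le> u" "u \<le> 1" "a \<ge> 0" "c \<ge> 0"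
  shows "0 \<le> biased_update w b u a c" "biased_update w b u a c \<le> 1"
proof -
  let ?num = "w * u + u powr b * a"
  let ?den = "w + u powr b * a + (1 - u) powr b * c"
  have "w * u \<le> w" using assms by (simp add: mult_left_le)
  moreover have "0 \<le> w * u" "0 \<le> u powr b * a" "0 \<le> (1 - u) powr b * c"
    using assms by auto
  ultimately have "0 \<le> ?num" "?num \<le> ?den"
    by linarith+
  moreover from this have "?den = 0 \<or> ?den > 0"
    by linarith
  ultimately show "0 \<le> biased_update w b u a c" "biased_update w b u a c \<le> 1"
    unfolding biased_update_def by (auto simp only: divide_nonneg_pos divide_le_eq_1_pos div_by_0)
qed

text \<open>The quotient of the new and the old distance is at most
  \<open>(w + m a) / (w + (1 - u)\<^sup>b c)\<close> with \<open>m = u\<^sup>b\<^sup>-\<^sup>1\<close>. Its limit differs between \<open>b = 1\<close>, where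
  \<open>m\<close> is constantly 1, and \<open>b > 1\<close>, where \<open>m\<close> vanishes in the limit.\<close>

lemma biased_update_contraction:
  fixes u a c :: "'a \<Rightarrow> real"
  assumes w: "w \<ge> 0" and b: "b \<ge> 1"
    and u: "(u \<longlongrightarrow> 0) G" and a: "(a \<longlongrightarrow> a0) G" and c: "(c \<longlongrightarrow> c0) G"
    and nonneg: "eventually (\<lambda>x. 0 \<le> u x \<and> 0 \<le> a x) G"
    and c0: "c0 > 0" and stable: "a0 < c0 \<or> b > 1"
  obtains \<rho> where "0 < \<rho>" "\<rho> < 1"
    "eventually (\<lambda>x. w + u x powr b * a x + (1 - u x) powr b * c x > 0 \<and>
       0 \<le> biased_update w b (u x) (a x) (c x) \<and>
       biased_update w b (u x) (a x) (c x) \<le> \<rho> * u x) G"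
proof -
  \<comment> \<open>The value at \<open>b = 1\<close> is set by hand, since \<open>0 powr 0 = 0\<close> would make \<open>m\<close>
      discontinuous there.\<close>
  define m where "m x = (if b = 1 then 1 else u x powr (b - 1))" for x
  define m0 :: real where "m0 = (if b = 1 then 1 else 0)"
  have m: "(m \<longlongrightarrow> m0) G"
  proof (cases "b = 1")
    case False
    have "((\<lambda>x. u x powr (b - 1)) \<longlongrightarrow> 0 powr (b - 1)) G"
      using u b False nonneg
      by (intro tendsto_powr') (auto elim: eventually_mono)
    then show ?thesis using False by (simp add: m_def[abs_def] m0_def)
  qed (simp add: m_def[abs_def] m0_def)
  define q where "q x = w + (1 - u x) powr b * c x" for x
  have "(q \<longlongrightarrow> w + (1 - 0) powr b * c0) G"
    unfolding q_def by (intro tendsto_intros u c) auto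
  then have q: "(q \<longlongrightarrow> w + c0) G" by simp
  have lim: "((\<lambda>x. (w + m x * a x) / q x) \<longlongrightarrow> (w + m0 * a0) / (w + c0)) G"
    using w c0 by (intro tendsto_intros m a q) auto
  have "(w + m0 * a0) / (w + c0) < 1"
    using w c0 stable b by (auto simp: m0_def divide_less_eq_1)
  then obtain \<rho> where \<rho>: "max 0 ((w + m0 * a0) / (w + c0)) < \<rho>" "\<rho> < 1"
    using dense[of "max 0 ((w + m0 * a0) / (w + c0))" 1] by auto
  have "eventually (\<lambda>x. (w + m x * a x) / q x < \<rho>) G"
    using lim \<rho> by (intro order_tendstoD) auto
  moreover have "eventually (\<lambda>x. q x > 0) G"
    using w c0 by (intro order_tendstoD(1)[OF q]) simp
  ultimately have "eventually (\<lambda>x. w + u x powr b * a x + (1 - u x) powr b * c x > 0 \<and>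
       0 \<le> biased_update w b (u x) (a x) (c x) \<and>
       biased_update w b (u x) (a x) (c x) \<le> \<rho> * u x) G"
    using nonneg
  proof eventually_elim
    case (elim x)
    have pw: "u x powr b = u x * m x"
    proof (cases "u x = 0")
      case False
      then show ?thesis
        using elim by (simp add: m_def powr_diff)
    qed simp
    have ua: "0 \<le> u x powr b * a x"
      using elim by simp
    then have le: "q x \<le> w + u x powr b * a x + (1 - u x) powr b * c x"
      by (simp add: q_def)
    have num: "w * u x + u x powr b * a x = u x * (w + m x * a x)"
      unfolding pw by (simp add: algebra_simps)
    have numpos: "0 \<le> w * u x + u x powr b * a x"
      using ua w elim by simp
    have "biased_update w b (u x) (a x) (c x) \<le> (w * u x + u x powr b * a x) / q x"
      unfolding biased_update_def using le numpos elim by (intro divide_left_mono) auto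
    also have "\<dots> = u x * ((w + m x * a x) / q x)"
      by (simp add: num)
    also have "\<dots> \<le> u x * \<rho>"
      using elim by (intro mult_left_mono) auto
    finally have "biased_update w b (u x) (a x) (c x) \<le> \<rho> * u x"
      by (simp add: mult.commute)
    moreover have pos: "w + u x powr b * a x + (1 - u x) powr b * c x > 0"
      using le elim by linarith
    moreover have "0 \<le> biased_update w b (u x) (a x) (c x)"
      unfolding biased_update_def using numpos pos by simp
    ultimately show ?case by blast
  qed
  with \<rho> that show thesis by auto
qed

section \<open>Polarized states of a network\<close>

definition polarized_state :: "'n set \<Rightarrow> real^'n::finite" where
  "polarized_state A = (\<chi> i. if i \<in> A then 0 else 1)"

definition camp_weight :: "('n \<times> 'n) set \<Rightarrow> real^'n^'n \<Rightarrow> 'n set \<Rightarrow> 'n::finite \<Rightarrow> real" where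
  "camp_weight E W S i = (\<Sum>j\<in>neighbors E i \<inter> S. W $ i $ j)"

lemma opinion_map_eq_biased_update:
  "opinion_map E W b x $ i =
     biased_update (W $ i $ i) (b $ i) (x $ i) (neighbor_opinion E W x i)
       (neighbor_weight E W i - neighbor_opinion E W x i)"
  by (simp add: opinion_map_def biased_update_def Let_def)

lemma neighbor_opinion_polarized:
  "neighbor_opinion E W (polarized_state A) i = camp_weight E W (- A) i"
proof -
  have "neighbor_opinion E W (polarized_state A) i =
      (\<Sum>j\<in>neighbors E i. if j \<in> - A then W $ i $ j else 0)"
    unfolding neighbor_opinion_def polarized_state_def by (intro sum.cong) auto
  also have "\<dots> = camp_weight E W (- A) i"
    unfolding camp_weight_def by (subst sum.inter_restrict) auto
  finally show ?thesis .
qed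

lemma neighbor_weight_split:
  "neighbor_weight E W i = camp_weight E W A i + camp_weight E W (- A) i"
proof -
  have "neighbors E i = (neighbors E i \<inter> A) \<union> (neighbors E i \<inter> - A)" by auto
  then show ?thesis
    unfolding neighbor_weight_def camp_weight_def
    by (subst sum.union_disjoint[symmetric]) auto
qed

lemma neighbor_opinion_bounds:
  assumes "\<And>i j. W $ i $ j \<ge> 0" and "x \<in> cbox 0 1"
  shows "0 \<le> neighbor_opinion E W x i" "neighbor_opinion E W x i \<le> neighbor_weight E W i"
proof -
  have x: "0 \<le> x $ j" "x $ j \<le> 1" for j
    using assms(2) by (auto simp: mem_box_cart)
  show "0 \<le> neighbor_opinion E W x i"
    unfolding neighbor_opinion_def using assms(1) x by (intro sum_nonneg) auto
  show "neighbor_opinion E W x i \<le> neighbor_weight E W i"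
    unfolding neighbor_opinion_def neighbor_weight_def
    using assms(1) x by (intro sum_mono) (simp add: mult_left_le)
qed

lemma opinion_map_in_cube:
  assumes W: "\<And>i j. W $ i $ j \<ge> 0" and x: "x \<in> cbox 0 1"
  shows "opinion_map E W b x \<in> cbox 0 1"
proof -
  have "0 \<le> opinion_map E W b x $ i \<and> opinion_map E W b x $ i \<le> 1" for i
    unfolding opinion_map_eq_biased_update
    using W x neighbor_opinion_bounds[OF W x, of E i]
    by (intro conjI biased_update_bounds) (auto simp: mem_box_cart)
  then show ?thesis by (simp add: mem_box_cart)
qed

text \<open>An agent of the camp \<open>A\<close> is described by its opinion itself; for an agent of the other
  camp the complementary opinion plays this role, and the pulls are swapped.\<close>

lemma polarized_agent_contraction:
  fixes E :: "('n::finite \<times> 'n) set"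
  assumes W: "\<And>i j. W $ i $ j \<ge> 0" and b: "b $ i \<ge> 1"
    and camp: "camp = (if i \<in> A then A else - A)"
    and own: "camp_weight E W camp i > 0"
    and stable: "camp_weight E W (- camp) i < camp_weight E W camp i \<or> b $ i > 1"
  shows "\<exists>\<rho>. 0 < \<rho> \<and> \<rho> < 1 \<and>
    eventually (\<lambda>x. \<bar>opinion_map E W b x $ i - polarized_state A $ i\<bar>
                     \<le> \<rho> * \<bar>x $ i - polarized_state A $ i\<bar>)
      (inf (nhds (polarized_state A)) (principal (cbox 0 1)))"
proof -
  let ?xe = "polarized_state A :: real^'n"
  define G where "G = inf (nhds ?xe) (principal (cbox 0 1))"
  define s where "s x = neighbor_opinion E W x i" for x
  define d where "d = neighbor_weight E W i"
  have "G \<le> nhds ?xe"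
    by (simp add: G_def)
  then have lim: "((\<lambda>x. x) \<longlongrightarrow> ?xe) G"
    by (simp add: filterlim_def)
  have xi: "((\<lambda>x. x $ i) \<longlongrightarrow> ?xe $ i) G"
    by (intro tendsto_intros lim)
  have "(s \<longlongrightarrow> s ?xe) G"
    unfolding s_def neighbor_opinion_def by (intro tendsto_intros lim)
  then have s: "(s \<longlongrightarrow> camp_weight E W (- A) i) G"
    unfolding s_def neighbor_opinion_polarized .
  have "((\<lambda>x. d - s x) \<longlongrightarrow> d - camp_weight E W (- A) i) G"
    by (intro tendsto_intros s)
  then have ds: "((\<lambda>x. d - s x) \<longlongrightarrow> camp_weight E W A i) G"
    by (simp add: d_def neighbor_weight_split[of E W i A])
  have cube: "eventually (\<lambda>x. x \<in> cbox 0 1) G"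
    unfolding G_def by (simp add: eventually_inf_principal)
  then have bounds: "eventually (\<lambda>x. 0 \<le> x $ i \<and> x $ i \<le> 1 \<and> 0 \<le> s x \<and> s x \<le> d) G"
  proof eventually_elim
    case (elim x)
    then show ?case
      using neighbor_opinion_bounds[OF W elim, of E i] by (auto simp: mem_box_cart s_def d_def)
  qed
  have F: "opinion_map E W b x $ i = biased_update (W $ i $ i) (b $ i) (x $ i) (s x) (d - s x)"
    for x
    by (simp add: opinion_map_eq_biased_update s_def d_def)
  show ?thesis
  proof (cases "i \<in> A")
    case True
    then have xe: "?xe $ i = 0" and camp: "camp = A"
      using camp by (auto simp: polarized_state_def)
    have u: "((\<lambda>x. x $ i) \<longlongrightarrow> 0) G" using xi xe by simp
    have nn: "eventually (\<lambda>x. 0 \<le> x $ i \<and> 0 \<le> s x) G"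
      using bounds by (auto elim: eventually_mono)
    obtain \<rho> where \<rho>: "0 < \<rho>" "\<rho> < 1" and ev:
      "eventually (\<lambda>x. W $ i $ i + x $ i powr b $ i * s x + (1 - x $ i) powr b $ i * (d - s x) > 0 \<and>
         0 \<le> biased_update (W $ i $ i) (b $ i) (x $ i) (s x) (d - s x) \<and>
         biased_update (W $ i $ i) (b $ i) (x $ i) (s x) (d - s x) \<le> \<rho> * x $ i) G"
      by (rule biased_update_contraction[OF W[of i i] b u s ds nn own[unfolded camp]
            stable[unfolded camp]])
    have "eventually (\<lambda>x. \<bar>opinion_map E W b x $ i - ?xe $ i\<bar> \<le> \<rho> * \<bar>x $ i - ?xe $ i\<bar>) G"
      using ev bounds by eventually_elim (simp add: F xe)
    with \<rho> show ?thesis unfolding G_def by blast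
  next
    case False
    then have xe: "?xe $ i = 1" and camp: "camp = - A"
      using camp by (auto simp: polarized_state_def)
    have "((\<lambda>x. 1 - x $ i) \<longlongrightarrow> 1 - 1) G"
      using xi xe by (intro tendsto_intros) simp
    then have u: "((\<lambda>x. 1 - x $ i) \<longlongrightarrow> 0) G" by simp
    have nn: "eventually (\<lambda>x. 0 \<le> 1 - x $ i \<and> 0 \<le> d - s x) G"
      using bounds by (auto elim: eventually_mono)
    obtain \<rho> where \<rho>: "0 < \<rho>" "\<rho> < 1" and ev:
      "eventually (\<lambda>x. W $ i $ i + (1 - x $ i) powr b $ i * (d - s x)
             + (1 - (1 - x $ i)) powr b $ i * s x > 0 \<and>
         0 \<le> biased_update (W $ i $ i) (b $ i) (1 - x $ i) (d - s x) (s x) \<and>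
         biased_update (W $ i $ i) (b $ i) (1 - x $ i) (d - s x) (s x) \<le> \<rho> * (1 - x $ i)) G"
      by (rule biased_update_contraction[OF W[of i i] b u ds s nn own[unfolded camp double_compl]
            stable[unfolded camp double_compl]])
    have "eventually (\<lambda>x. \<bar>opinion_map E W b x $ i - ?xe $ i\<bar> \<le> \<rho> * \<bar>x $ i - ?xe $ i\<bar>) G"
      using ev bounds
    proof eventually_elim
      case (elim x)
      then have "1 - opinion_map E W b x $ i =
          biased_update (W $ i $ i) (b $ i) (1 - x $ i) (d - s x) (s x)"
        unfolding F by (intro biased_update_complement) (simp add: algebra_simps)
      then have "\<bar>opinion_map E W b x $ i - 1\<bar> =
          biased_update (W $ i $ i) (b $ i) (1 - x $ i) (d - s x) (s x)"
        using elim by linarith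
      moreover have "\<bar>x $ i - 1\<bar> = 1 - x $ i" using elim by simp
      ultimately show ?case using elim unfolding xe by simp
    qed
    with \<rho> show ?thesis unfolding G_def by blast
  qed
qed

text \<open>Coordinatewise bounds with a common factor bound the Euclidean distance by the same
  factor.\<close>

lemma polarized_state_contraction:
  fixes E :: "('n::finite \<times> 'n) set" and A :: "'n set"
  assumes W: "\<And>i j. W $ i $ j \<ge> 0" and b: "\<And>i. b $ i \<ge> 1"
    and own: "\<And>i. camp_weight E W (if i \<in> A then A else - A) i > 0"
    and stable: "\<And>i. camp_weight E W (- (if i \<in> A then A else - A)) i
                    < camp_weight E W (if i \<in> A then A else - A) i \<or> b $ i > 1"
  obtains \<rho> where "0 < \<rho>" "\<rho> < 1"
    "eventually (\<lambda>x. dist (opinion_map E W b x) (polarized_state A) \<le> \<rho> * dist x (polarized_state A))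
      (inf (nhds (polarized_state A)) (principal (cbox 0 1)))"
proof -
  let ?xe = "polarized_state A :: real^'n"
  let ?G = "inf (nhds ?xe) (principal (cbox 0 1))"
  have "\<forall>i. \<exists>\<rho>. 0 < \<rho> \<and> \<rho> < 1 \<and>
    eventually (\<lambda>x. \<bar>opinion_map E W b x $ i - ?xe $ i\<bar> \<le> \<rho> * \<bar>x $ i - ?xe $ i\<bar>) ?G"
    by (intro allI polarized_agent_contraction[OF W b refl own stable])
  from choice[OF this] obtain r where r: "\<And>i. 0 < r i" "\<And>i. r i < 1" and
    ev: "\<And>i. eventually (\<lambda>x. \<bar>opinion_map E W b x $ i - ?xe $ i\<bar> \<le> r i * \<bar>x $ i - ?xe $ i\<bar>) ?G"
    by blast
  define \<rho> where "\<rho> = Max (range r)"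
  have le: "r i \<le> \<rho>" for i
    unfolding \<rho>_def by (intro Max_ge) auto
  have "\<rho> \<in> range r"
    unfolding \<rho>_def by (intro Max_in) auto
  then have \<rho>: "0 < \<rho>" "\<rho> < 1" using r by auto
  have "eventually (\<lambda>x. \<forall>i. \<bar>opinion_map E W b x $ i - ?xe $ i\<bar> \<le> r i * \<bar>x $ i - ?xe $ i\<bar>) ?G"
    using ev by (intro eventually_all_finite) auto
  then have "eventually (\<lambda>x. dist (opinion_map E W b x) ?xe \<le> \<rho> * dist x ?xe) ?G"
  proof eventually_elim
    case (elim x)
    have "norm (opinion_map E W b x - ?xe) \<le> norm (\<rho> *\<^sub>R (x - ?xe))"
    proof (rule norm_le_componentwise_cart)
      fix i
      have "\<bar>opinion_map E W b x $ i - ?xe $ i\<bar> \<le> \<rho> * \<bar>x $ i - ?xe $ i\<bar>"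
        using elim le[of i] by (meson abs_ge_zero mult_right_mono order_trans)
      then show "norm ((opinion_map E W b x - ?xe) $ i) \<le> norm ((\<rho> *\<^sub>R (x - ?xe)) $ i)"
        using \<rho> by (simp add: abs_mult)
    qed
    then show ?case using \<rho> by (simp add: dist_norm)
  qed
  with \<rho> that show thesis by blast
qed

section \<open>Two-island networks\<close>

lemma camp_weight_unit:
  assumes "irrefl E" and "\<And>j. i \<noteq> j \<Longrightarrow> W $ i $ j = 1"
  shows "camp_weight E W S i = real (card (neighbors E i \<inter> S))"
proof -
  have "W $ i $ j = 1" if "j \<in> neighbors E i" for j
    using assms that by (force simp: neighbors_def irrefl_def)
  then show ?thesis by (simp add: camp_weight_def)
qed

theorem theorem6:
  fixes E :: "('n::finite \<times> 'n) set" and V1 V2 :: "'n set" and ps pd :: real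
    and W :: "real^'n^'n" and b :: "real^'n"
  assumes "two_island_network E V1 V2 ps pd"
    and "connected_graph E"
    and "\<And>i. W $ i $ i \<ge> 0"
    and "\<And>i j. i \<noteq> j \<Longrightarrow> W $ i $ j = 1"
    and "\<And>i. b $ i \<ge> 1"
    and "ps > pd \<or> (\<forall>i. b $ i > 1)"
  defines "xe \<equiv> (\<chi> i. if i \<in> V1 then 0 else 1)"
  shows "equilibrium_on (cbox 0 1) (opinion_map E W b) xe \<and>
         locally_exponentially_stable_on (cbox 0 1) (opinion_map E W b) xe"
proof -
  note net = assms(1)[unfolded two_island_network_def]
  have V2: "V2 = - V1" using net by auto
  have W: "W $ i $ j \<ge> 0" for i j
    using assms(3)[of i] assms(4)[of i j] by (cases "i = j") auto
  have cw: "camp_weight E W S i = real (card (neighbors E i \<inter> S))" for S i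
    using net assms(4) by (intro camp_weight_unit) auto
  let ?camp = "\<lambda>i. if i \<in> V1 then V1 else - V1"
  have own: "camp_weight E W (?camp i) i = real (card (?camp i)) * ps"
    and other: "camp_weight E W (- ?camp i) i = real (card (?camp i)) * pd" for i
    using net unfolding cw V2 by auto
  have card: "real (card (?camp i)) > 0" for i
    by (auto simp: card_gt_0_iff)
  have xe: "xe = polarized_state V1"
    by (simp add: xe_def polarized_state_def)
  have own_pos: "camp_weight E W (?camp i) i > 0" for i
    unfolding own using card[of i] net by (intro mult_pos_pos) auto
  have stable: "camp_weight E W (- ?camp i) i < camp_weight E W (?camp i) i \<or> b $ i > 1" for i
    unfolding own other using card[of i] assms(6) by (auto intro: mult_strict_left_mono)
  obtain \<rho> where "0 < \<rho>" "\<rho> < 1"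
    "eventually (\<lambda>x. dist (opinion_map E W b x) xe \<le> \<rho> * dist x xe)
      (inf (nhds xe) (principal (cbox 0 1)))"
    unfolding xe by (rule polarized_state_contraction[OF W assms(5) own_pos stable])
  moreover have "xe \<in> cbox 0 1"
    by (simp add: xe_def mem_box_cart)
  ultimately show ?thesis
    using opinion_map_in_cube[OF W] by (intro local_contraction_imp_stable)
qed

end
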